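(* Let $L$ be a locally compact Hausdorff space. Suppose $A$ is a C$^*$-algebra such that every 2-local derivation on $A$ is a (linear) derivation. Then every 2-local derivation on $C_0(L,A)$ is a (linear) derivation.
   Context: All C$^*$-algebras are complex. $C_0(L,A)$ is the C$^*$-algebra of all continuous functions $X:L\to A$ vanishing at infinity, with pointwise operations and the supremum norm. A derivation on a C$^*$-algebra $B$ is a linear map $D:B\to B$ with $D(ab)=D(a)b+aD(b)$ for all $a,b\in B$. A (not necessarily linear nor continuous) mapping $\Delta:B\to B$ is a 2-local derivation on $B$ if for every $x,y\in B$ there is a derivation $D_{x,y}$ on $B$, depending on $x$ and $y$, such that $\Delta(x)=D_{x,y}(x)$ and $\Delta(y)=D_{x,y}(y)$. *)

theory Defs
  imports "HOL-Analysis.Analysis" "HOL-Library.Function_Algebras"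
begin

section \<open>Complex algebras and C*-algebras\<close>

text \<open>Algebras are associative, but neither commutative nor unital in general.\<close>

class scaleC =
  fixes scaleC :: "complex \<Rightarrow> 'a \<Rightarrow> 'a" (infixr "*\<^sub>C" 75)

class complex_algebra = ring + scaleC +
  assumes scaleC_add_right: "a *\<^sub>C (x + y) = a *\<^sub>C x + a *\<^sub>C y"
    and scaleC_add_left: "(a + b) *\<^sub>C x = a *\<^sub>C x + b *\<^sub>C x"
    and scaleC_scaleC: "a *\<^sub>C (b *\<^sub>C x) = (a * b) *\<^sub>C x"
    and scaleC_one: "1 *\<^sub>C x = x"
    and mult_scaleC_left: "(a *\<^sub>C x) * y = a *\<^sub>C (x * y)"
    and mult_scaleC_right: "x * (a *\<^sub>C y) = a *\<^sub>C (x * y)"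

text \<open>
  The classes \<^class>\<open>real_normed_algebra\<close> and \<^class>\<open>banach\<close> provide the complete,
  submultiplicative norm; \<open>scaleR_scaleC\<close> says that their real scalar
  multiplication is the restriction of the complex one.
\<close>

class cstar_algebra = complex_algebra + real_normed_algebra + banach +
  fixes star :: "'a \<Rightarrow> 'a"
  assumes scaleR_scaleC: "r *\<^sub>R x = complex_of_real r *\<^sub>C x"
    and norm_scaleC: "norm (a *\<^sub>C x) = cmod a * norm x"
    and star_star: "star (star x) = x"
    and star_add: "star (x + y) = star x + star y"
    and star_scaleC: "star (a *\<^sub>C x) = cnj a *\<^sub>C star x"
    and star_mult: "star (x * y) = star y * star x"
    and cstar_identity: "norm (star x * x) = (norm x)\<^sup>2"

instantiation complex :: cstar_algebra
begin
definition scaleC_complex :: "complex \<Rightarrow> complex \<Rightarrow> complex"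
  where "scaleC_complex a x = a * x"
definition star_complex :: "complex \<Rightarrow> complex"
  where "star_complex = cnj"
instance
  by standard
    (simp_all add: scaleC_complex_def star_complex_def algebra_simps norm_mult
      power2_eq_square scaleR_conv_of_real)
end

text \<open>Together with \<^theory>\<open>HOL-Library.Function_Algebras\<close>, this makes all
  algebra-valued functions on a type into a complex algebra under pointwise operations.\<close>

instantiation "fun" :: (type, scaleC) scaleC
begin
definition scaleC_fun :: "complex \<Rightarrow> ('a \<Rightarrow> 'b) \<Rightarrow> 'a \<Rightarrow> 'b"
  where "scaleC_fun a f = (\<lambda>x. a *\<^sub>C f x)"
instance ..
end

lemma scaleC_fun_apply [simp]: "(a *\<^sub>C f) x = a *\<^sub>C f x"
  by (simp add: scaleC_fun_def)

instance "fun" :: (type, complex_algebra) complex_algebra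
  by standard
    (simp_all add: fun_eq_iff scaleC_add_right scaleC_add_left scaleC_scaleC scaleC_one
      mult_scaleC_left mult_scaleC_right)


section \<open>Derivations and 2-local derivations\<close>

text \<open>
  These notions are relative to a carrier \<open>B\<close>, intended to be a complex subalgebra of the
  ambient type.  They only concern the restriction of \<open>D\<close> and \<open>\<Delta>\<close> to \<open>B\<close>;
  values outside \<open>B\<close> are irrelevant.
\<close>

definition derivation_on :: "'b::complex_algebra set \<Rightarrow> ('b \<Rightarrow> 'b) \<Rightarrow> bool"
  where "derivation_on B D \<longleftrightarrow>
    (\<forall>a\<in>B. D a \<in> B) \<and>
    (\<forall>a\<in>B. \<forall>b\<in>B. D (a + b) = D a + D b) \<and>
    (\<forall>c. \<forall>a\<in>B. D (c *\<^sub>C a) = c *\<^sub>C D a) \<and>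
    (\<forall>a\<in>B. \<forall>b\<in>B. D (a * b) = D a * b + a * D b)"

definition two_local_derivation_on :: "'b::complex_algebra set \<Rightarrow> ('b \<Rightarrow> 'b) \<Rightarrow> bool"
  where "two_local_derivation_on B \<Delta> \<longleftrightarrow>
    (\<forall>x\<in>B. \<Delta> x \<in> B) \<and>
    (\<forall>x\<in>B. \<forall>y\<in>B. \<exists>D. derivation_on B D \<and> \<Delta> x = D x \<and> \<Delta> y = D y)"


section \<open>Continuous functions vanishing at infinity\<close>

text \<open>
  A function on \<^term>\<open>topspace L\<close> is represented by its extension by zero to the
  whole type, so that the pointwise operations of the function type restrict to \<open>C0 L\<close>.
\<close>

definition C0 :: "'l topology \<Rightarrow> ('l \<Rightarrow> 'a::cstar_algebra) set"
  where "C0 L = {f. continuous_map L euclidean f \<and>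
    (\<forall>e>0. \<exists>K. compactin L K \<and> (\<forall>t\<in>topspace L - K. norm (f t) < e)) \<and>
    (\<forall>t. t \<notin> topspace L \<longrightarrow> f t = 0)}"

text \<open>The supremum norm plays no role for derivations, which are purely algebraic; the
  following facts show that \<open>C0 L\<close> is a *-algebra of bounded functions.\<close>

lemma C0_bounded:
  assumes "f \<in> C0 L"
  shows "bounded (range f)"
proof -
  obtain K where K: "compactin L K" "\<And>t. t \<in> topspace L - K \<Longrightarrow> norm (f t) < 1"
    using assms unfolding C0_def by (auto dest: spec[where x = 1])
  have "compactin euclidean (f ` K)"
    using K(1) assms unfolding C0_def by (blast intro: image_compactin)
  then have "bounded (f ` K)"
    by (simp add: compact_imp_bounded)
  moreover have "range f \<subseteq> f ` K \<union> cball 0 1"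
  proof
    fix y assume "y \<in> range f"
    then obtain t where t: "y = f t" by blast
    have "t \<notin> topspace L \<Longrightarrow> f t = 0"
      using assms unfolding C0_def by blast
    then show "y \<in> f ` K \<union> cball 0 1"
      using K(2)[of t] t by (cases "t \<in> K"; cases "t \<in> topspace L") auto
  qed
  ultimately show ?thesis
    by (meson bounded_Un bounded_cball bounded_subset)
qed

lemma C0_comp:
  fixes f :: "'l \<Rightarrow> 'a::cstar_algebra" and h :: "'a \<Rightarrow> 'b::cstar_algebra"
  assumes f: "f \<in> C0 L" and h: "continuous_on UNIV h"
    and M: "\<And>x. norm (h x) \<le> M * norm x"
  shows "(\<lambda>t. h (f t)) \<in> C0 L"
proof -
  have "continuous_map L euclidean (h \<circ> f)"
    by (rule continuous_map_compose[where X' = euclidean]) (use f h in \<open>auto simp: C0_def\<close>)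
  moreover have "\<exists>K. compactin L K \<and> (\<forall>t\<in>topspace L - K. norm (h (f t)) < e)" if "e > 0" for e
  proof -
    have pos: "e / (\<bar>M\<bar> + 1) > 0" using that by simp
    then obtain K where K: "compactin L K" "\<forall>t\<in>topspace L - K. norm (f t) < e / (\<bar>M\<bar> + 1)"
      using f unfolding C0_def by blast
    have "norm (h (f t)) < e" if "t \<in> topspace L - K" for t
    proof -
      have "norm (h (f t)) \<le> (\<bar>M\<bar> + 1) * norm (f t)"
        by (rule order_trans[OF M]) (simp add: mult_right_mono)
      also have "\<dots> < e" using K(2) that by (simp add: field_simps)
      finally show ?thesis .
    qed
    with K(1) show ?thesis by blast
  qed
  moreover have "h 0 = 0" using M[of 0] by simp
  ultimately show ?thesis using f by (simp add: C0_def o_def)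
qed

lemma zero_in_C0: "0 \<in> C0 L"
  by (auto simp: C0_def zero_fun_def intro!: exI[of _ "{}"])

lemma add_in_C0:
  assumes "f \<in> C0 L" "g \<in> C0 L"
  shows "f + g \<in> C0 L"
proof -
  have "continuous_map L euclidean (f + g)"
    using assms unfolding C0_def plus_fun_def by (auto intro: continuous_map_add)
  moreover have "\<exists>K. compactin L K \<and> (\<forall>t\<in>topspace L - K. norm ((f + g) t) < e)" if "e > 0" for e
  proof -
    from that have "e / 2 > 0" by simp
    then obtain K K' where "compactin L K" "\<forall>t\<in>topspace L - K. norm (f t) < e / 2"
      "compactin L K'" "\<forall>t\<in>topspace L - K'. norm (g t) < e / 2"
      using assms unfolding C0_def by blast
    note K = this
    have "norm ((f + g) t) < e" if "t \<in> topspace L - (K \<union> K')" for t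
    proof -
      have "norm (f t) < e / 2" "norm (g t) < e / 2"
        using K(2,4) that by blast+
      then show ?thesis
        using norm_triangle_ineq[of "f t" "g t"] by simp
    qed
    with compactin_Un[OF K(1,3)] show ?thesis by blast
  qed
  ultimately show ?thesis using assms by (simp add: C0_def)
qed

lemma scaleC_in_C0:
  assumes "f \<in> C0 L"
  shows "a *\<^sub>C f \<in> C0 L"
proof -
  have "bounded_linear (\<lambda>x::'b. a *\<^sub>C x)"
    by (rule bounded_linear_intro[where K = "cmod a"])
      (simp_all add: scaleC_add_right scaleR_scaleC scaleC_scaleC norm_scaleC mult.commute)
  then show ?thesis
    unfolding scaleC_fun_def
    by (intro C0_comp[OF assms, where M = "cmod a"])
      (rule linear_continuous_on, assumption, simp add: norm_scaleC)
qed

lemma mult_in_C0: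
  assumes f: "f \<in> C0 L" and g: "g \<in> C0 L"
  shows "f * g \<in> C0 L"
proof -
  have "continuous_map L euclidean (f * g)"
    using f g unfolding C0_def continuous_map_atin times_fun_def
    by (auto intro: tendsto_mult)
  moreover have "\<exists>K. compactin L K \<and> (\<forall>t\<in>topspace L - K. norm ((f * g) t) < e)" if "e > 0" for e
  proof -
    obtain M where M: "M > 0" "\<And>t. norm (f t) \<le> M"
      using C0_bounded[OF f] unfolding bounded_pos by auto
    with that have "e / M > 0" by simp
    then obtain K where K: "compactin L K" "\<forall>t\<in>topspace L - K. norm (g t) < e / M"
      using g unfolding C0_def by blast
    have "norm ((f * g) t) < e" if "t \<in> topspace L - K" for t
    proof -
      have "norm ((f * g) t) \<le> norm (f t) * norm (g t)"
        by (simp add: norm_mult_ineq)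
      also have "\<dots> \<le> M * norm (g t)" using M by (simp add: mult_right_mono)
      also have "\<dots> < e" using K(2) that M(1) by (simp add: field_simps)
      finally show ?thesis .
    qed
    with K(1) show ?thesis by blast
  qed
  ultimately show ?thesis using f by (simp add: C0_def)
qed

lemma norm_star: "norm (star x) = norm (x::'a::cstar_algebra)"
proof -
  have le: "norm y \<le> norm (star y)" for y :: 'a
  proof (cases "norm y = 0")
    case False
    have "norm y * norm y \<le> norm (star y) * norm y"
      using norm_mult_ineq[of "star y" y] by (simp add: cstar_identity power2_eq_square)
    with False show ?thesis by (simp add: mult_le_cancel_right)
  qed simp
  from le[of x] le[of "star x"] show ?thesis by (simp add: star_star)
qed

lemma star_in_C0:
  assumes "f \<in> C0 L"
  shows "(\<lambda>t. star (f t)) \<in> C0 L"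
proof -
  have "bounded_linear (star :: 'b \<Rightarrow> 'b)"
    by (rule bounded_linear_intro[where K = 1])
      (simp_all add: star_add scaleR_scaleC star_scaleC norm_star)
  then show ?thesis
    by (intro C0_comp[OF assms, where M = 1])
      (rule linear_continuous_on, assumption, simp add: norm_star)
qed

end

theory Submission
  imports Defs
begin

text \<open>
  A derivation \<open>D\<close> of \<open>C0 L\<close> is local: if \<open>g t = 0\<close> then \<open>D g t = 0\<close>.  Hence \<open>D\<close> induces a
  derivation of \<open>A\<close> in every fibre, namely \<open>g t \<mapsto> D g t\<close>, and a 2-local derivation \<open>\<Delta>\<close> induces
  likewise a 2-local derivation of \<open>A\<close> in every fibre.  By assumption these fibre maps are
  derivations, and therefore so is \<open>\<Delta>\<close>, whose values are computed fibrewise.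
\<close>

lemma scaleC_minus_one: "(-1) *\<^sub>C x = - (x::'a::cstar_algebra)"
  using scaleR_scaleC[of "-1" x] by simp

lemma mult_star_eq_0_iff: "x * star x = 0 \<longleftrightarrow> x = (0::'a::cstar_algebra)"
  using cstar_identity[of "star x"] by (auto simp: star_star norm_star)

text \<open>\<open>C0_comp\<close> asks for a linear bound on \<open>h\<close>, which fails near 0
  for the square-root-like map that defines \<open>k\<close> below. Continuity at 0 with
  \<open>h 0 = 0\<close> already carries decay at infinity from \<open>f\<close> to \<open>h\<close>
  after \<open>f\<close>.\<close>

lemma C0_compose:
  fixes f :: "'l \<Rightarrow> 'a::cstar_algebra" and h :: "'a \<Rightarrow> 'b::cstar_algebra"
  assumes f: "f \<in> C0 L" and h: "continuous_on UNIV h" and h0: "h 0 = 0"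
  shows "(\<lambda>t. h (f t)) \<in> C0 L"
proof -
  have "continuous_map L euclidean (h \<circ> f)"
    by (rule continuous_map_compose[where X' = euclidean]) (use f h in \<open>auto simp: C0_def\<close>)
  moreover have "\<exists>K. compactin L K \<and> (\<forall>t\<in>topspace L - K. norm (h (f t)) < e)" if "e > 0" for e
  proof -
    obtain d where d: "d > 0" "\<And>x. norm x < d \<Longrightarrow> norm (h x) < e"
      using h \<open>e > 0\<close> h0 unfolding continuous_on_iff
      by (metis UNIV_I dist_0_norm dist_commute)
    with f obtain K where "compactin L K" "\<forall>t\<in>topspace L - K. norm (f t) < d"
      unfolding C0_def by blast
    with d(2) show ?thesis by blast
  qed
  ultimately show ?thesis using f h0 by (simp add: C0_def o_def)
qed

text \<open>Bounded continuous scalar functions act as multipliers of \<open>C0 L\<close>.\<close>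

lemma scaleR_in_C0:
  fixes a :: "'l \<Rightarrow> 'a::cstar_algebra"
  assumes a: "a \<in> C0 L" and \<phi>: "continuous_map L euclideanreal \<phi>"
    and M: "\<And>s. \<bar>\<phi> s\<bar> \<le> M"
  shows "(\<lambda>s. \<phi> s *\<^sub>R a s) \<in> C0 L"
proof -
  have "continuous_map L euclidean (\<lambda>s. \<phi> s *\<^sub>R a s)"
    using a \<phi> unfolding C0_def continuous_map_atin by (auto intro: tendsto_scaleR)
  moreover have "\<exists>K. compactin L K \<and> (\<forall>t\<in>topspace L - K. norm (\<phi> t *\<^sub>R a t) < e)"
    if "e > 0" for e
  proof -
    \<comment> \<open>The bound at an arbitrary point gives M \<ge> 0; adding 1 makes the divisor
      positive even when \<open>M\<close> is 0.\<close>
    have M1: "M + 1 > 0" using M[of undefined] by linarith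
    with that have "e / (M + 1) > 0" by simp
    with a obtain K where K: "compactin L K" "\<forall>t\<in>topspace L - K. norm (a t) < e / (M + 1)"
      unfolding C0_def by blast
    have "norm (\<phi> t *\<^sub>R a t) < e" if "t \<in> topspace L - K" for t
    proof -
      have "norm (\<phi> t *\<^sub>R a t) \<le> (M + 1) * norm (a t)"
        using M[of t] by (simp add: mult_right_mono)
      also have "\<dots> < e" using K(2) that M1 by (simp add: field_simps)
      finally show ?thesis .
    qed
    with K(1) show ?thesis by blast
  qed
  ultimately show ?thesis using a by (simp add: C0_def)
qed

text \<open>Multiply \<open>c\<close> by a bump function at \<open>t\<close> supported in a compact
  neighbourhood; complete regularity supplies it.\<close>

lemma C0_attains_value:
  fixes c :: "'a::cstar_algebra"
  assumes lc: "locally_compact_space L" and H: "Hausdorff_space L" and t: "t \<in> topspace L"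
  shows "\<exists>g\<in>C0 L. g t = c"
proof -
  obtain U K where UK: "openin L U" "compactin L K" "t \<in> U" "U \<subseteq> K"
    using lc t unfolding locally_compact_space_def by blast
  have "completely_regular_space L"
    using lc H by (simp add: locally_compact_regular_imp_completely_regular_space)
  moreover have "closedin L (topspace L - U)" "t \<in> topspace L - (topspace L - U)"
    using UK t by auto
  ultimately obtain f where f: "continuous_map L (top_of_set {0..1::real}) f" "f t = 0"
      "f ` (topspace L - U) \<subseteq> {1}"
    unfolding completely_regular_space_def by meson
  have f': "continuous_map L euclideanreal f"
    using f(1) by (simp add: continuous_map_in_subtopology)
  \<comment> \<open>As \<open>f\<close> is 0 at \<open>t\<close> and 1 off \<open>U\<close>, the
    bump is \<open>1 - f\<close>. The value 0 off \<open>topspace L\<close> is demanded by the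
    encoding of \<open>C0\<close>.\<close>
  define g where "g = (\<lambda>s. if s \<in> topspace L then (1 - f s) *\<^sub>R c else 0)"
  have "continuous_map L euclidean (\<lambda>s. (1 - f s) *\<^sub>R c)"
    using f' unfolding continuous_map_atin by (auto intro!: tendsto_intros)
  then have "continuous_map L euclidean g"
    by (rule continuous_map_eq) (simp add: g_def)
  moreover have "\<exists>K. compactin L K \<and> (\<forall>s\<in>topspace L - K. norm (g s) < e)" if "e > 0" for e
  proof (intro exI conjI ballI)
    fix s assume "s \<in> topspace L - K"
    with f(3) UK(4) have "f s = 1" by blast
    with that show "norm (g s) < e" by (simp add: g_def)
  qed (rule UK(2))
  moreover have "g s = 0" if "s \<notin> topspace L" for s
    using that by (simp add: g_def)
  ultimately have "g \<in> C0 L"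
    unfolding C0_def by blast
  moreover have "g t = c" using t f(2) by (simp add: g_def)
  ultimately show ?thesis by blast
qed

text \<open>Only the point 0 is delicate: the value there is 0, since \<open>inverse 0 = 0\<close>,
  and elsewhere the norm is \<open>sqrt (norm x)\<close>, which tends to 0.\<close>

lemma continuous_on_scaleR_inverse_sqrt_norm:
  "continuous_on UNIV (\<lambda>x::'a::real_normed_vector. x /\<^sub>R sqrt (norm x))"
proof (rule continuous_at_imp_continuous_on, intro ballI)
  fix x :: 'a
  show "isCont (\<lambda>x. x /\<^sub>R sqrt (norm x)) x"
  proof (cases "x = 0")
    case True
    have "((\<lambda>y::'a. sqrt (norm y)) \<longlongrightarrow> sqrt (norm (0::'a))) (at 0)"
      by (intro tendsto_intros)
    moreover have "norm (y /\<^sub>R sqrt (norm y)) = sqrt (norm y)" for y :: 'a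
      by (cases "y = 0") (simp_all add: field_simps)
    ultimately have "((\<lambda>y::'a. y /\<^sub>R sqrt (norm y)) \<longlongrightarrow> 0) (at 0)"
      by (subst tendsto_norm_zero_iff[symmetric]) (simp only: norm_zero real_sqrt_zero)
    then show ?thesis using True by (simp add: isCont_def)
  qed (auto intro!: continuous_intros)
qed

lemma derivation_on_C0_minus:
  fixes x y :: "'l \<Rightarrow> 'a::cstar_algebra"
  assumes "derivation_on (C0 L) D" "x \<in> C0 L" "y \<in> C0 L"
  shows "x - y \<in> C0 L" "D (x - y) = D x - D y"
proof -
  have m: "(-1) *\<^sub>C z = - z" for z :: "'l \<Rightarrow> 'a"
    by (simp add: fun_eq_iff scaleC_minus_one)
  have y: "- y \<in> C0 L" "D (- y) = - D y"
    using scaleC_in_C0[OF assms(3), of "-1"] assms(1,3) m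
    unfolding derivation_on_def by metis+
  show "x - y \<in> C0 L" using add_in_C0[OF assms(2) y(1)] by simp
  have "D (x + - y) = D x + D (- y)"
    using assms(1,2) y(1) unfolding derivation_on_def by blast
  then show "D (x - y) = D x - D y" using y(2) by simp
qed

text \<open>
  Write \<open>g = \<phi> k\<close> with \<open>\<phi> = \<parallel>g\<parallel>\<^sup>1\<^sup>/\<^sup>2\<close> scalar-valued and \<open>\<phi> t = 0\<close>, \<open>k t = 0\<close>.  Since \<open>A\<close> need not
  be unital, \<open>\<phi>\<close> is only a multiplier of \<open>C0 L\<close>; expanding \<open>D (g a) = D (k (\<phi> a))\<close> in two ways
  shows \<open>D g t * a t = 0\<close>, and one takes \<open>a = (D g)\<^sup>*\<close>.
\<close>

lemma derivation_on_C0_local: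
  fixes g :: "'l \<Rightarrow> 'a::cstar_algebra"
  assumes D: "derivation_on (C0 L) D" and g: "g \<in> C0 L" and gt: "g t = 0"
  shows "D g t = 0"
proof -
  define \<phi> where "\<phi> = (\<lambda>s. sqrt (norm (g s)))"
  define k where "k = (\<lambda>s. g s /\<^sub>R sqrt (norm (g s)))"
  define a where "a = (\<lambda>s. star (D g s))"
  define b where "b = (\<lambda>s. \<phi> s *\<^sub>R a s)"
  have prod: "D (x * y) = D x * y + x * D y" if "x \<in> C0 L" "y \<in> C0 L" for x y
    using D that unfolding derivation_on_def by blast
  have "D g \<in> C0 L" using D g unfolding derivation_on_def by blast
  then have a: "a \<in> C0 L" unfolding a_def by (rule star_in_C0)
  have k: "k \<in> C0 L"
    unfolding k_def by (rule C0_compose[OF g continuous_on_scaleR_inverse_sqrt_norm]) simp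
  obtain M where "\<And>s. norm (g s) \<le> M"
    using C0_bounded[OF g] unfolding bounded_iff by auto
  then have "\<bar>\<phi> s\<bar> \<le> sqrt M" for s by (simp add: \<phi>_def)
  moreover have "continuous_map L euclideanreal \<phi>"
    using g unfolding \<phi>_def C0_def continuous_map_atin by (auto intro!: tendsto_intros)
  ultimately have b: "b \<in> C0 L" unfolding b_def by (intro scaleR_in_C0[OF a])
  have "g s * a s = k s * b s" for s
    by (cases "g s = 0") (simp_all add: k_def b_def \<phi>_def)
  then have "g * a = k * b" by (simp add: fun_eq_iff)
  then have "D g * a + g * D a = D k * b + k * D b"
    using prod[OF g a] prod[OF k b] by simp
  \<comment> \<open>At \<open>t\<close> the factors \<open>g\<close>, \<open>k\<close> and
    \<open>b\<close> all vanish, so only \<open>D g * a\<close> survives.\<close>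
  then have "(D g * a + g * D a) t = (D k * b + k * D b) t" by simp
  then have "D g t * star (D g t) = 0"
    using gt by (simp add: a_def b_def k_def \<phi>_def)
  then show ?thesis by (simp add: mult_star_eq_0_iff)
qed

text \<open>Apply locality to \<open>x - y\<close>: the value of \<open>D x\<close> at
  \<open>t\<close> depends on \<open>x t\<close> alone.\<close>

lemma derivation_on_C0_eq_at:
  assumes D: "derivation_on (C0 L) D" and xy: "x \<in> C0 L" "y \<in> C0 L" and "x t = y t"
  shows "D x t = D y t"
proof -
  have "D (x - y) t = 0"
    by (rule derivation_on_C0_local[OF D derivation_on_C0_minus(1)[OF D xy]])
      (simp add: \<open>x t = y t\<close>)
  then show ?thesis unfolding derivation_on_C0_minus(2)[OF D xy] by simp
qed

text \<open>Additivity of \<Delta> is not yet available, so no difference is formed; instead a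
  derivation agreeing with \<Delta> at both \<open>x\<close> and \<open>y\<close> is compared at
  \<open>t\<close>.\<close>

lemma two_local_derivation_on_C0_eq_at:
  assumes "two_local_derivation_on (C0 L) \<Delta>" "x \<in> C0 L" "y \<in> C0 L" "x t = y t"
  shows "\<Delta> x t = \<Delta> y t"
  using assms derivation_on_C0_eq_at unfolding two_local_derivation_on_def by metis

text \<open>\<open>E\<close> is an arbitrary section of evaluation at \<open>t\<close>, possibly
  nonlinear. Still, \<open>E (a + b)\<close> and \<open>E a + E b\<close> agree at \<open>t\<close>,
  hence so do their images under \<open>D\<close>; likewise for multiples and products.\<close>

lemma derivation_on_fibre:
  fixes D :: "('l \<Rightarrow> 'a::cstar_algebra) \<Rightarrow> 'l \<Rightarrow> 'a"
  assumes D: "derivation_on (C0 L) D" and E: "\<And>c. E c \<in> C0 L" "\<And>c. E c t = c"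
  shows "derivation_on UNIV (\<lambda>c. D (E c) t)"
proof -
  note eq = derivation_on_C0_eq_at[OF D E(1)]
  have "D (E (a + b)) t = D (E a + E b) t" for a b
    by (rule eq[OF add_in_C0[OF E(1) E(1)]]) (simp add: E(2))
  moreover have "D (E a + E b) = D (E a) + D (E b)" for a b
    using D E(1) unfolding derivation_on_def by blast
  moreover have "D (E (z *\<^sub>C a)) t = D (z *\<^sub>C E a) t" for z a
    by (rule eq[OF scaleC_in_C0[OF E(1)]]) (simp add: E(2))
  moreover have "D (z *\<^sub>C E a) = z *\<^sub>C D (E a)" for z a
    using D E(1) unfolding derivation_on_def by blast
  moreover have "D (E (a * b)) t = D (E a * E b) t" for a b
    by (rule eq[OF mult_in_C0[OF E(1) E(1)]]) (simp add: E(2))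
  moreover have "D (E a * E b) = D (E a) * E b + E a * D (E b)" for a b
    using D E(1) unfolding derivation_on_def by blast
  ultimately show ?thesis
    unfolding derivation_on_def by (simp add: E(2))
qed

text \<open>A derivation matching \<Delta> at \<open>E a\<close> and \<open>E b\<close> induces,
  through the same section \<open>E\<close>, a derivation of the fibre matching at \<open>a\<close>
  and \<open>b\<close>.\<close>

lemma two_local_derivation_on_fibre:
  fixes \<Delta> :: "('l \<Rightarrow> 'a::cstar_algebra) \<Rightarrow> 'l \<Rightarrow> 'a"
  assumes \<Delta>: "two_local_derivation_on (C0 L) \<Delta>" and E: "\<And>c. E c \<in> C0 L" "\<And>c. E c t = c"
  shows "two_local_derivation_on UNIV (\<lambda>c. \<Delta> (E c) t)"
  unfolding two_local_derivation_on_def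
proof (intro conjI ballI)
  fix a b
  obtain D where D: "derivation_on (C0 L) D" "\<Delta> (E a) = D (E a)" "\<Delta> (E b) = D (E b)"
    using \<Delta> E(1) unfolding two_local_derivation_on_def by blast
  then show "\<exists>D'. derivation_on UNIV D' \<and> \<Delta> (E a) t = D' a \<and> \<Delta> (E b) t = D' b"
    using derivation_on_fibre[OF D(1) E] by auto
qed simp

theorem theorem2p8:
  fixes L :: "'l topology"
  assumes "locally_compact_space L" and "Hausdorff_space L"
    and "\<forall>\<Delta> :: 'a::cstar_algebra \<Rightarrow> 'a.
      two_local_derivation_on UNIV \<Delta> \<longrightarrow> derivation_on UNIV \<Delta>"
  shows "\<forall>\<Delta> :: ('l \<Rightarrow> 'a) \<Rightarrow> ('l \<Rightarrow> 'a).
      two_local_derivation_on (C0 L) \<Delta> \<longrightarrow> derivation_on (C0 L) \<Delta>"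
proof (intro allI impI)
  fix \<Delta> :: "('l \<Rightarrow> 'a) \<Rightarrow> ('l \<Rightarrow> 'a)"
  assume \<Delta>: "two_local_derivation_on (C0 L) \<Delta>"
  have \<Delta>_in: "\<Delta> x \<in> C0 L" if "x \<in> C0 L" for x
    using \<Delta> that unfolding two_local_derivation_on_def by blast
  have outside: "x t = 0" if "x \<in> C0 L" "t \<notin> topspace L" for x :: "'l \<Rightarrow> 'a" and t
    using that unfolding C0_def by blast
  have fibre: "\<exists>d. derivation_on UNIV d \<and> (\<forall>x\<in>C0 L. \<Delta> x t = d (x t))"
    if t: "t \<in> topspace L" for t
  proof -
    have "\<forall>c::'a. \<exists>g. g \<in> C0 L \<and> g t = c"
      using C0_attains_value[OF assms(1,2) t] by blast
    then obtain E :: "'a \<Rightarrow> 'l \<Rightarrow> 'a" where E: "\<And>c. E c \<in> C0 L" "\<And>c. E c t = c"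
      using choice[of "\<lambda>c g. g \<in> C0 L \<and> g t = c"] by blast
    have "derivation_on UNIV (\<lambda>c. \<Delta> (E c) t)"
      using assms(3) two_local_derivation_on_fibre[OF \<Delta> E] by blast
    \<comment> \<open>\<open>x\<close> and \<open>E (x t)\<close> take the same value at
      \<open>t\<close>, so the fibre map computes \<Delta> on all of \<open>C0 L\<close>.\<close>
    moreover have "\<Delta> x t = \<Delta> (E (x t)) t" if "x \<in> C0 L" for x
      using two_local_derivation_on_C0_eq_at[OF \<Delta> that E(1)] E(2) by simp
    ultimately show ?thesis by blast
  qed
  \<comment> \<open>The identities are checked pointwise on the whole type: by the fibre derivation
    on \<open>topspace L\<close>, and as 0 = 0 elsewhere.\<close>
  have "\<Delta> (x + y) t = (\<Delta> x + \<Delta> y) t \<and> \<Delta> (z *\<^sub>C x) t = (z *\<^sub>C \<Delta> x) t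
      \<and> \<Delta> (x * y) t = (\<Delta> x * y + x * \<Delta> y) t"
    if x: "x \<in> C0 L" and y: "y \<in> C0 L" for x y z t
  proof (cases "t \<in> topspace L")
    case True
    obtain d where d: "derivation_on UNIV d" "\<And>x. x \<in> C0 L \<Longrightarrow> \<Delta> x t = d (x t)"
      using fibre[OF True] by blast
    show ?thesis
      using d(1) x y unfolding derivation_on_def
      by (simp add: d(2) add_in_C0 mult_in_C0 scaleC_in_C0)
  next
    case False
    have "\<Delta> u t = 0" if "u \<in> C0 L" for u
      using outside[OF \<Delta>_in[OF that] False] .
    moreover have "z *\<^sub>C (0::'a) = 0"
      using norm_scaleC[of z "0::'a"] by simp
    ultimately show ?thesis
      using x y by (simp add: add_in_C0 mult_in_C0 scaleC_in_C0)
  qed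
  then show "derivation_on (C0 L) \<Delta>"
    unfolding derivation_on_def using \<Delta>_in by (auto simp: fun_eq_iff)
qed

end
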